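(* Let $\beta\in\mathbb{R}$, let $c:G\to\mathbb{R}$ be a continuous cocycle, and let $M$ be a Borel probability measure on $X$ that is $(c,\beta)$-quasi-invariant. Then $$\int_X f(x)\,dM(x)=\int_X H_{-\beta c}(f)(x)\,dM(x)\qquad\text{for all } f\in C^0(X),$$ where $H_{-\beta c}$ is the Haar operator $$H_{-\beta c}(f)(x)=\frac{1}{\sharp[x]}\sum_{s\in[x]} f(s)\,e^{-\beta c(x,s)}.$$
   Context: Let $d\ge 1$ be an integer and $X=\{1,\dots,d\}^{\mathbb{N}}$, a compact metric space with the usual metric $d_X(x,z)=2^{-\min\{n\ge1:\ x_n\ne z_n\}}$ ($d_X(x,x)=0$). For $j\in\{1,\dots,d\}$ and $x=(x_1,x_2,\dots)\in X$ write $j*x=(j,x_1,x_2,\dots)$. Let $\sim$ be an equivalence relation on $X$ with finite classes $[x]=\{s\in X: s\sim x\}$, such that $x\mapsto[x]$ is hemicontinuous as a multivalued map. Let $G=\{(x,y)\in X^2: x\sim y\}$ with the topology induced from $X^2$; $X$ is identified with $G^0=\{(x,x):x\in X\}$. For each $x$, $\nu^x$ denotes the counting measure on $[x]$. The relation $\sim$ (the groupoid $G$) is assumed continuous with respect to the symbolic structure: the elements of each class $[y]$ are listed (each exactly once) as an ordered tuple $(\psi_1(y),\dots,\psi_k(y))$, $k=\sharp[y]$, where this ordered list depends only on the class $[y]$, and for every $\varepsilon>0$ there is $\delta>0$ such that, whenever $d_X(x,z)<\delta$ and $1\le j\le d$, one has $\sharp[j*x]=\sharp[j*z]=:k$ and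 $\max_{1\le i\le k} d_X(\psi_i(j*x),\psi_i(j*z))<\varepsilon$. A cocycle is a function $c:G\to\mathbb{R}$ with $c(x,z)=c(x,y)+c(y,z)$ for all $x\sim y\sim z$. A Borel probability $M$ on $X$ is $(c,\beta)$-quasi-invariant if $$\int_X\sum_{s\in[x]} h(s,x)\,dM(x)=\int_X\sum_{s\in[x]} h(x,s)\,e^{-\beta c(x,s)}\,dM(x)$$ for every integrable $h:G\to\mathbb{R}$, meaning every Borel $h$ for which both double integrals converge absolutely. *)

theory Defs
  imports "HOL-Probability.Probability"
begin

text \<open>A word \<open>x = (x\<^sub>1, x\<^sub>2, \<dots>)\<close> over the alphabet \<open>{1..d}\<close> is stored with positions
  shifted by one: \<open>x n\<close> is the letter \<open>x\<^sub>n\<^sub>+\<^sub>1\<close>.\<close>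

type_synonym word = "nat \<Rightarrow> nat"

definition words :: "nat \<Rightarrow> word set" where
  "words d = {x. \<forall>n. x n \<in> {1..d}}"

text \<open>The \<open>Suc\<close> in the exponent compensates the shift of positions.\<close>

definition word_dist :: "word \<Rightarrow> word \<Rightarrow> real" where
  "word_dist x z = (if x = z then 0 else (1 / 2) ^ Suc (LEAST n. x n \<noteq> z n))"

definition prepend :: "nat \<Rightarrow> word \<Rightarrow> word" where
  "prepend j x = case_nat j x"

lemma Metric_space_words: "Metric_space (words d) word_dist"
proof
  fix x y z :: word
  show "0 \<le> word_dist x y"
    by (simp add: word_dist_def)
  show "word_dist x y = word_dist y x"
    by (simp add: word_dist_def eq_commute)
  show "word_dist x y = 0 \<longleftrightarrow> x = y"
    by (simp add: word_dist_def)
  show "word_dist x z \<le> word_dist x y + word_dist y z"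
  proof (cases "x = z \<or> x = y \<or> y = z")
    case True
    then show ?thesis by (auto simp: word_dist_def)
  next
    case False
    define n where "n = (LEAST n. x n \<noteq> z n)"
    have "x n \<noteq> z n"
      unfolding n_def by (rule LeastI_ex) (use False in auto)
    then have "x n \<noteq> y n \<or> y n \<noteq> z n" by auto
    then have "(LEAST n. x n \<noteq> y n) \<le> n \<or> (LEAST n. y n \<noteq> z n) \<le> n"
      by (meson Least_le)
    then have "(1 / 2 :: real) ^ Suc n \<le> (1 / 2) ^ Suc (LEAST n. x n \<noteq> y n)
        \<or> (1 / 2 :: real) ^ Suc n \<le> (1 / 2) ^ Suc (LEAST n. y n \<noteq> z n)"
      by (auto intro!: power_decreasing simp del: power_Suc)
    moreover have "0 \<le> (1 / 2 :: real) ^ Suc m" for m by simp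
    ultimately show ?thesis
      using False unfolding word_dist_def n_def[symmetric] by (smt (verit))
  qed
qed

definition word_top :: "nat \<Rightarrow> word topology" where
  "word_top d = Metric_space.mtopology (words d) word_dist"

definition groupoid_top :: "nat \<Rightarrow> (word \<times> word) set \<Rightarrow> (word \<times> word) topology" where
  "groupoid_top d G = subtopology (prod_topology (word_top d) (word_top d)) G"

definition borel_of_top :: "'a topology \<Rightarrow> 'a measure" where
  "borel_of_top T = sigma (topspace T) {U. openin T U}"

text \<open>Hemicontinuous means both upper (first clause) and lower (second clause) hemicontinuous.\<close>

definition hemicontinuous_map :: "'a topology \<Rightarrow> 'b topology \<Rightarrow> ('a \<Rightarrow> 'b set) \<Rightarrow> bool" where
  "hemicontinuous_map S T F \<longleftrightarrow>
     (\<forall>U. openin T U \<longrightarrow> openin S {x \<in> topspace S. F x \<subseteq> U}) \<and>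
     (\<forall>U. openin T U \<longrightarrow> openin S {x \<in> topspace S. F x \<inter> U \<noteq> {}})"

text \<open>The equivalence relation is represented by its graph \<open>G\<close>, so that the class of \<open>x\<close> is
  \<open>G `` {x}\<close>. The list \<open>\<psi> y\<close> is the ordered enumeration \<open>(\<psi>\<^sub>1(y), \<dots>, \<psi>\<^sub>k(y))\<close> of the class of
  \<open>y\<close>, again with positions shifted by one.\<close>

definition continuous_relation :: "nat \<Rightarrow> (word \<times> word) set \<Rightarrow> bool" where
  "continuous_relation d G \<longleftrightarrow>
     (\<exists>\<psi> :: word \<Rightarrow> word list.
        (\<forall>y \<in> words d. distinct (\<psi> y) \<and> set (\<psi> y) = G `` {y}) \<and>
        (\<forall>(x, y) \<in> G. \<psi> x = \<psi> y) \<and>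
        (\<forall>\<epsilon> > 0. \<exists>\<delta> > 0. \<forall>x \<in> words d. \<forall>z \<in> words d. \<forall>j \<in> {1..d}.
           word_dist x z < \<delta> \<longrightarrow>
             card (G `` {prepend j x}) = card (G `` {prepend j z}) \<and>
             (\<forall>i < card (G `` {prepend j x}).
                word_dist (\<psi> (prepend j x) ! i) (\<psi> (prepend j z) ! i) < \<epsilon>)))"

definition cocycle :: "(word \<times> word) set \<Rightarrow> (word \<times> word \<Rightarrow> real) \<Rightarrow> bool" where
  "cocycle G c \<longleftrightarrow>
     (\<forall>x y z. (x, y) \<in> G \<longrightarrow> (y, z) \<in> G \<longrightarrow> c (x, z) = c (x, y) + c (y, z))"

text \<open>The first two premises on \<open>h\<close> express absolute convergence of the two double integrals with
  respect to the counting measures on the classes and \<open>M\<close>.\<close>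

definition quasi_invariant ::
    "nat \<Rightarrow> (word \<times> word) set \<Rightarrow> (word \<times> word \<Rightarrow> real) \<Rightarrow> real \<Rightarrow> word measure \<Rightarrow> bool" where
  "quasi_invariant d G c \<beta> M \<longleftrightarrow>
     (\<forall>h \<in> borel_measurable (borel_of_top (groupoid_top d G)).
        integrable M (\<lambda>x. \<Sum>s \<in> G `` {x}. \<bar>h (s, x)\<bar>) \<longrightarrow>
        integrable M (\<lambda>x. \<Sum>s \<in> G `` {x}. \<bar>h (x, s) * exp (- \<beta> * c (x, s))\<bar>) \<longrightarrow>
        (LINT x|M. (\<Sum>s \<in> G `` {x}. h (s, x))) =
        (LINT x|M. (\<Sum>s \<in> G `` {x}. h (x, s) * exp (- \<beta> * c (x, s)))))"

text \<open>\<open>haar_op G V\<close> is the Haar operator \<open>H\<^sub>V\<close>; it is used with \<open>V = - \<beta> c\<close>.\<close>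

definition haar_op ::
    "(word \<times> word) set \<Rightarrow> (word \<times> word \<Rightarrow> real) \<Rightarrow> (word \<Rightarrow> real) \<Rightarrow> word \<Rightarrow> real" where
  "haar_op G V f x =
     1 / real (card (G `` {x})) * (\<Sum>s \<in> G `` {x}. f s * exp (V (x, s)))"

end

theory Submission
  imports Defs
begin

text \<open>Apply quasi-invariance to \<open>h (s, x) = f x / \<sharp>[x]\<close>: the left-hand inner sum collapses to \<open>f x\<close>,
  and since the cardinality is constant on classes the right-hand one is the Haar operator. What
  remains is the admissibility of \<open>h\<close>. Every word has a first letter, so the continuity
  hypothesis on \<open>\<psi>\<close> makes class cardinalities locally constant and, on each set where the
  cardinality is \<open>k\<close>, makes \<open>\<psi>\<^sub>1, \<dots>, \<psi>\<^sub>k\<close> continuous. Hence \<open>h\<close> and both inner sums are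
  continuous, and they are bounded because the space of words is compact.\<close>

section \<open>Topology of the word space\<close>

lemma topspace_word_top [simp]: "topspace (word_top d) = words d"
  unfolding word_top_def by (rule Metric_space.topspace_mtopology[OF Metric_space_words])

lemma openin_word_top:
  "openin (word_top d) U \<longleftrightarrow>
     U \<subseteq> words d \<and> (\<forall>x \<in> U. \<exists>r > 0. \<forall>z \<in> words d. word_dist x z < r \<longrightarrow> z \<in> U)"
proof -
  interpret Metric_space "words d" word_dist
    by (rule Metric_space_words)
  show ?thesis
    unfolding word_top_def openin_mtopology
    by (intro conj_cong refl) (simp add: subset_iff Ball_def in_mball, blast)
qed

text \<open>The first disagreement, if any, has index at least \<open>n\<close>; the extra
  \<open>Suc\<close> in the exponent of \<open>word_dist\<close> then makes the inequality
  strict.\<close>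

lemma word_dist_less_if_agree:
  assumes "\<And>i. i < n \<Longrightarrow> x i = z i"
  shows "word_dist x z < (1 / 2) ^ n"
proof (cases "x = z")
  case False
  then have "\<exists>n. x n \<noteq> z n"
    by auto
  then have "x (LEAST n. x n \<noteq> z n) \<noteq> z (LEAST n. x n \<noteq> z n)"
    by (rule LeastI_ex)
  then have "n \<le> (LEAST n. x n \<noteq> z n)"
    using assms not_le_imp_less by blast
  then have "(1 / 2 :: real) ^ Suc (LEAST n. x n \<noteq> z n) < (1 / 2) ^ n"
    by (intro power_strict_decreasing) auto
  with False show ?thesis
    by (simp add: word_dist_def)
qed (simp add: word_dist_def)

text \<open>A common first letter pushes the first disagreement one place further, which costs one
  factor 1/2. This relates the distance of two words to that of their tails.\<close>

lemma word_dist_prepend: "word_dist (prepend j x) (prepend j z) = word_dist x z / 2"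
proof (cases "x = z")
  case False
  then obtain n where "prepend j x (Suc n) \<noteq> prepend j z (Suc n)"
    by (auto simp: prepend_def)
  then have "(LEAST n. prepend j x n \<noteq> prepend j z n)
      = Suc (LEAST n. prepend j x (Suc n) \<noteq> prepend j z (Suc n))"
    by (rule Least_Suc) (simp add: prepend_def)
  moreover have "prepend j x \<noteq> prepend j z"
    using \<open>prepend j x (Suc n) \<noteq> prepend j z (Suc n)\<close> by auto
  ultimately show ?thesis
    using False by (simp add: word_dist_def prepend_def)
qed (simp add: word_dist_def)

lemma prepend_tail: "prepend (x 0) (\<lambda>n. x (Suc n)) = x"
  by (auto simp: prepend_def fun_eq_iff split: nat.split)

text \<open>By Tychonoff the product of finite discrete alphabets is compact, and the identity maps
  it continuously onto the metric space of words: every metric ball contains a cylinder around its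
  centre.\<close>

lemma compact_space_word_top: "compact_space (word_top d)"
proof -
  let ?P = "product_topology (\<lambda>_ :: nat. discrete_topology {1..d}) UNIV"
  have top_P: "topspace ?P = words d"
    by (auto simp: words_def PiE_def Pi_def)
  have "continuous_map ?P (word_top d) (\<lambda>x. x)"
    unfolding continuous_map_def
  proof (intro conjI allI impI)
    show "(\<lambda>x. x) \<in> topspace ?P \<rightarrow> topspace (word_top d)"
      unfolding top_P by simp
  next
    fix U assume U: "openin (word_top d) U"
    then have sub: "U \<subseteq> words d"
      by (simp add: openin_word_top)
    have "\<exists>T. openin ?P T \<and> x \<in> T \<and> T \<subseteq> U" if "x \<in> U" for x
    proof -
      obtain r where r: "r > 0" "\<And>z. z \<in> words d \<Longrightarrow> word_dist x z < r \<Longrightarrow> z \<in> U"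
        using U \<open>x \<in> U\<close> unfolding openin_word_top by blast
      obtain n where n: "(1 / 2 :: real) ^ n < r"
        using real_arch_pow_inv[of r "1 / 2"] r by auto
      \<comment> \<open>The cylinder of words sharing the first \<open>n\<close> letters of
        \<open>x\<close>. It restricts only finitely many factors, so it is open in the product, and
        it lies within distance (1/2)^n of \<open>x\<close>.\<close>
      let ?T = "\<Pi>\<^sub>E i\<in>UNIV. if i < n then {x i} else {1..d}"
      have xd: "x i \<in> {1..d}" for i
        using that sub by (auto simp: words_def)
      have "openin ?P ?T"
        unfolding openin_PiE_gen
        by (intro disjI2 conjI ballI)
          (use xd in \<open>auto intro: finite_subset[of _ "{..<n}"]\<close>)
      moreover have "x \<in> ?T"
        using xd by (auto simp: PiE_def)
      moreover have "?T \<subseteq> U"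
      proof
        fix z assume z: "z \<in> ?T"
        then have *: "z i \<in> (if i < n then {x i} else {1..d})" for i
          by (auto simp: PiE_def Pi_def)
        have "z i \<in> {1..d}" for i
          using *[of i] xd[of i] by (cases "i < n") auto
        then have "z \<in> words d"
          by (simp add: words_def)
        moreover have "x i = z i" if "i < n" for i
          using *[of i] that by simp
        then have "word_dist x z < r"
          using word_dist_less_if_agree[of n x z] n by simp
        ultimately show "z \<in> U"
          by (rule r(2))
      qed
      ultimately show ?thesis
        by blast
    qed
    then have "openin ?P U"
      by (subst openin_subopen) blast
    moreover have "{x \<in> topspace ?P. x \<in> U} = U"
      unfolding top_P using sub by auto
    ultimately show "openin ?P {x \<in> topspace ?P. x \<in> U}"
      by simp
  qed
  moreover have "compact_space ?P"
    by (simp add: compact_space_product_topology compact_space_discrete_topology)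
  ultimately have "compactin (word_top d) ((\<lambda>x. x) ` topspace ?P)"
    unfolding compact_space_def by (rule image_compactin[rotated])
  then show ?thesis
    unfolding compact_space_def top_P by simp
qed

section \<open>Borel measurability and integrability of continuous functions\<close>

lemma sets_borel_of_top: "sets (borel_of_top T) = sigma_sets (topspace T) {U. openin T U}"
  and space_borel_of_top [simp]: "space (borel_of_top T) = topspace T"
proof -
  \<comment> \<open>\<open>sigma\<close> yields the generated sigma-algebra only for a family of
    subsets of the carrier.\<close>
  have "{U. openin T U} \<subseteq> Pow (topspace T)"
    by (auto dest: openin_subset)
  then show "sets (borel_of_top T) = sigma_sets (topspace T) {U. openin T U}"
    "space (borel_of_top T) = topspace T"
    by (simp_all add: borel_of_top_def)
qed

lemma borel_measurable_if_continuous_map: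
  fixes f :: "'a \<Rightarrow> real"
  assumes "continuous_map T euclideanreal f"
  shows "f \<in> borel_measurable (borel_of_top T)"
proof (rule borel_measurableI)
  fix S :: "real set"
  assume "open S"
  then have "openin T {x \<in> topspace T. f x \<in> S}"
    using assms by (auto simp: continuous_map_def)
  moreover have "f -` S \<inter> space (borel_of_top T) = {x \<in> topspace T. f x \<in> S}"
    by auto
  ultimately show "f -` S \<inter> space (borel_of_top T) \<in> sets (borel_of_top T)"
    by (simp add: sets_borel_of_top)
qed

text \<open>Compactness of the word space bounds \<open>f\<close>, and a bounded measurable function
  is integrable over a finite measure. This serves both integrability premises of
  \<open>quasi_invariant\<close>.\<close>

lemma integrable_if_continuous_map:
  fixes f :: "word \<Rightarrow> real"
  assumes "finite_measure M" and sets: "sets M = sets (borel_of_top (word_top d))"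
    and f: "continuous_map (word_top d) euclideanreal f"
  shows "integrable M f"
proof -
  interpret finite_measure M by fact
  have "compactin euclideanreal (f ` words d)"
    using image_compactin[OF _ f, of "words d"] compact_space_word_top[of d]
    by (simp add: compact_space_def)
  then have "bounded (f ` words d)"
    by (simp add: compact_imp_bounded)
  then obtain B where B: "\<And>x. x \<in> words d \<Longrightarrow> norm (f x) \<le> B"
    by (auto simp: bounded_iff)
  have "space M = words d"
    using sets_eq_imp_space_eq[OF sets] by simp
  then have "AE x in M. norm (f x) \<le> B"
    using B by (intro AE_I2) simp
  moreover have "f \<in> borel_measurable M"
    using borel_measurable_if_continuous_map[OF f] measurable_cong_sets[OF sets refl] by blast
  ultimately show ?thesis
    by (rule integrable_const_bound)
qed

section \<open>Continuity of class cardinalities and of the Haar operator\<close>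

text \<open>Frees the continuity hypothesis from the prepended letter: two words that are close
  enough share their first letter, so they arise by prepending it to their tails, and the hypothesis
  applies to the tails.\<close>

lemma uniform_enumeration:
  assumes "continuous_relation d G"
  obtains \<psi> :: "word \<Rightarrow> word list"
  where "\<And>y. y \<in> words d \<Longrightarrow> distinct (\<psi> y) \<and> set (\<psi> y) = G `` {y}"
    and "\<And>\<epsilon>. \<epsilon> > 0 \<Longrightarrow> \<exists>\<delta> > 0. \<forall>x \<in> words d. \<forall>z \<in> words d. word_dist x z < \<delta> \<longrightarrow>
      card (G `` {x}) = card (G `` {z}) \<and>
      (\<forall>i < card (G `` {x}). word_dist (\<psi> x ! i) (\<psi> z ! i) < \<epsilon>)"
proof -
  obtain \<psi> :: "word \<Rightarrow> word list"
    where enum: "\<And>y. y \<in> words d \<Longrightarrow> distinct (\<psi> y) \<and> set (\<psi> y) = G `` {y}"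
    and cont: "\<And>\<epsilon>. \<epsilon> > 0 \<Longrightarrow> \<exists>\<delta> > 0. \<forall>x \<in> words d. \<forall>z \<in> words d. \<forall>j \<in> {1..d}.
      word_dist x z < \<delta> \<longrightarrow> card (G `` {prepend j x}) = card (G `` {prepend j z}) \<and>
      (\<forall>i < card (G `` {prepend j x}).
        word_dist (\<psi> (prepend j x) ! i) (\<psi> (prepend j z) ! i) < \<epsilon>)"
    using assms unfolding continuous_relation_def by auto
  have "\<exists>\<delta> > 0. \<forall>x \<in> words d. \<forall>z \<in> words d. word_dist x z < \<delta> \<longrightarrow>
      card (G `` {x}) = card (G `` {z}) \<and>
      (\<forall>i < card (G `` {x}). word_dist (\<psi> x ! i) (\<psi> z ! i) < \<epsilon>)" if "\<epsilon> > 0" for \<epsilon>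
  proof -
    obtain \<delta> where "\<delta> > 0"
      and \<delta>: "\<And>x z j. x \<in> words d \<Longrightarrow> z \<in> words d \<Longrightarrow> j \<in> {1..d} \<Longrightarrow> word_dist x z < \<delta> \<Longrightarrow>
        card (G `` {prepend j x}) = card (G `` {prepend j z}) \<and>
        (\<forall>i < card (G `` {prepend j x}).
          word_dist (\<psi> (prepend j x) ! i) (\<psi> (prepend j z) ! i) < \<epsilon>)"
      using cont[OF \<open>\<epsilon> > 0\<close>] by blast
    show ?thesis
    proof (intro exI conjI ballI allI impI)
      \<comment> \<open>Words with different first letters are exactly 1/2 apart, so the bound 1/2
        forces equal first letters. The bound \<delta>/2 compensates for the tails being twice as
        far apart as the words.\<close>
      show "0 < min (1 / 2) (\<delta> / 2)"
        using \<open>\<delta> > 0\<close> by simp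
    next
      fix x z
      assume xz: "x \<in> words d" "z \<in> words d" and dist: "word_dist x z < min (1 / 2) (\<delta> / 2)"
      have "x 0 = z 0"
      proof (rule ccontr)
        assume ne: "x 0 \<noteq> z 0"
        then have "(LEAST n. x n \<noteq> z n) = 0"
          by (intro Least_eq_0)
        with ne have "word_dist x z = 1 / 2"
          by (auto simp: word_dist_def)
        with dist show False by simp
      qed
      let ?x = "\<lambda>n. x (Suc n)" and ?z = "\<lambda>n. z (Suc n)"
      have px: "prepend (x 0) ?x = x" and pz: "prepend (x 0) ?z = z"
        using prepend_tail[of x] prepend_tail[of z] \<open>x 0 = z 0\<close> by simp_all
      have "word_dist ?x ?z < \<delta>"
        using word_dist_prepend[of "x 0" ?x ?z] dist by (simp add: px pz)
      moreover have "?x \<in> words d" "?z \<in> words d" "x 0 \<in> {1..d}"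
        using xz by (auto simp: words_def)
      ultimately have *: "card (G `` {x}) = card (G `` {z}) \<and>
          (\<forall>i < card (G `` {x}). word_dist (\<psi> x ! i) (\<psi> z ! i) < \<epsilon>)"
        using \<delta>[of ?x ?z "x 0"] unfolding px pz by blast
      then show "card (G `` {x}) = card (G `` {z})" by simp
      fix i assume "i < card (G `` {x})"
      with * show "word_dist (\<psi> x ! i) (\<psi> z ! i) < \<epsilon>" by simp
    qed
  qed
  then show ?thesis
    by (intro that[of \<psi>] enum)
qed

text \<open>Uniform continuity with tolerance 1 gives a radius \<delta> such that the cardinality is
  constant on every \<delta>-ball.\<close>

lemma openin_card_class:
  assumes "continuous_relation d G"
  shows "openin (word_top d) {x \<in> words d. card (G `` {x}) = k}"
proof -
  obtain \<delta> where "\<delta> > 0"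
    "\<And>x z. x \<in> words d \<Longrightarrow> z \<in> words d \<Longrightarrow> word_dist x z < \<delta> \<Longrightarrow>
      card (G `` {x}) = card (G `` {z})"
    using uniform_enumeration[OF assms] zero_less_one[where 'a = real] by (metis (no_types))
  then show ?thesis
    unfolding openin_word_top by fastforce
qed

text \<open>The level sets of the cardinality form an open cover on whose members the function is
  constant; pasting gives continuity.\<close>

lemma continuous_map_card_class:
  assumes "continuous_relation d G"
  shows "continuous_map (word_top d) euclideanreal (\<lambda>x. real (card (G `` {x})))"
  by (rule pasting_lemma[where I = UNIV and T = "\<lambda>k. {x \<in> words d. card (G `` {x}) = k}"
        and f = "\<lambda>k _. real k"])
    (auto simp: openin_card_class[OF assms])

text \<open>On the open set \<open>?A k\<close> of words with class size \<open>k\<close>, the sum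
  over the class becomes a sum over the indices \<open>i < k\<close> of the enumeration, whose terms
  are continuous there. These local formulas are pasted together.\<close>

lemma continuous_map_haar_op:
  fixes f :: "word \<Rightarrow> real"
  assumes equiv: "equiv (words d) G" and rel: "continuous_relation d G"
    and V: "continuous_map (groupoid_top d G) euclideanreal V"
    and f: "continuous_map (word_top d) euclideanreal f"
  shows "continuous_map (word_top d) euclideanreal (haar_op G V f)"
proof -
  obtain \<psi> :: "word \<Rightarrow> word list"
    where enum: "\<And>y. y \<in> words d \<Longrightarrow> distinct (\<psi> y) \<and> set (\<psi> y) = G `` {y}"
    and cont: "\<And>\<epsilon>. \<epsilon> > 0 \<Longrightarrow> \<exists>\<delta> > 0. \<forall>x \<in> words d. \<forall>z \<in> words d. word_dist x z < \<delta> \<longrightarrow>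
      card (G `` {x}) = card (G `` {z}) \<and>
      (\<forall>i < card (G `` {x}). word_dist (\<psi> x ! i) (\<psi> z ! i) < \<epsilon>)"
    by (rule uniform_enumeration[OF rel]) iprover
  let ?A = "\<lambda>k. {x \<in> words d. card (G `` {x}) = k}"
  have G_words: "x \<in> words d \<and> s \<in> words d" if "(x, s) \<in> G" for x s
    using equiv that by (auto simp: equiv_def refl_on_def)
  have length: "length (\<psi> x) = card (G `` {x})" if "x \<in> words d" for x
    using enum[OF that] distinct_card[of "\<psi> x"] by simp
  have nth: "(x, \<psi> x ! i) \<in> G" if "x \<in> ?A k" "i < k" for x i k
    using that enum[of x] length[of x] nth_mem[of i "\<psi> x"] by auto
  have cont_\<psi>: "continuous_map (subtopology (word_top d) (?A k)) (word_top d) (\<lambda>x. \<psi> x ! i)"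
    if "i < k" for i k
    unfolding continuous_map_def
  proof (intro conjI allI impI)
    show "(\<lambda>x. \<psi> x ! i) \<in> topspace (subtopology (word_top d) (?A k)) \<rightarrow> topspace (word_top d)"
      using nth[OF _ that] G_words by auto
  next
    fix U assume U: "openin (word_top d) U"
    \<comment> \<open>The same radius must preserve the class size and keep the \<open>i\<close>-th
      entry within the ball inside \<open>U\<close>; the uniform estimate gives both at once, since
      \<open>i < k\<close> is an admissible index.\<close>
    have "\<exists>r > 0. \<forall>z \<in> words d. word_dist x z < r \<longrightarrow> z \<in> ?A k \<and> \<psi> z ! i \<in> U"
      if x: "x \<in> ?A k" "\<psi> x ! i \<in> U" for x
    proof -
      obtain r where "r > 0"
        and r: "\<And>z. z \<in> words d \<Longrightarrow> word_dist (\<psi> x ! i) z < r \<Longrightarrow> z \<in> U"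
        using U x unfolding openin_word_top by blast
      obtain \<delta> where "\<delta> > 0"
        and \<delta>: "\<And>z. z \<in> words d \<Longrightarrow> word_dist x z < \<delta> \<Longrightarrow> card (G `` {x}) = card (G `` {z}) \<and>
          (\<forall>i < card (G `` {x}). word_dist (\<psi> x ! i) (\<psi> z ! i) < r)"
        using cont[OF \<open>r > 0\<close>] x by blast
      have "z \<in> ?A k \<and> \<psi> z ! i \<in> U" if z: "z \<in> words d" "word_dist x z < \<delta>" for z
      proof -
        have "z \<in> ?A k" "word_dist (\<psi> x ! i) (\<psi> z ! i) < r"
          using \<delta>[OF z] z x \<open>i < k\<close> by auto
        then show ?thesis
          using r nth[OF _ \<open>i < k\<close>] G_words by blast
      qed
      with \<open>\<delta> > 0\<close> show ?thesis by blast
    qed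
    \<comment> \<open>Since \<open>?A k\<close> is itself open, openness in the subspace can be
      checked in the whole space.\<close>
    then have "openin (word_top d) {x \<in> ?A k. \<psi> x ! i \<in> U}"
      unfolding openin_word_top by auto
    moreover have "{x \<in> topspace (subtopology (word_top d) (?A k)). \<psi> x ! i \<in> U}
        = {x \<in> ?A k. \<psi> x ! i \<in> U}"
      by auto
    ultimately show "openin (subtopology (word_top d) (?A k))
        {x \<in> topspace (subtopology (word_top d) (?A k)). \<psi> x ! i \<in> U}"
      by (auto simp: openin_open_subtopology[OF openin_card_class[OF rel]])
  qed
  let ?g = "\<lambda>k x. 1 / real k * (\<Sum>i<k. f (\<psi> x ! i) * exp (V (x, \<psi> x ! i)))"
  show ?thesis
  proof (rule pasting_lemma[where I = UNIV and T = ?A and f = ?g])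
    fix k
    show "openin (word_top d) (?A k)"
      by (rule openin_card_class[OF rel])
    let ?S = "subtopology (word_top d) (?A k)"
    have "continuous_map ?S euclideanreal (\<lambda>x. f (\<psi> x ! i) * exp (V (x, \<psi> x ! i)))"
      if "i < k" for i
    proof (rule continuous_map_real_mult)
      show "continuous_map ?S euclideanreal (\<lambda>x. f (\<psi> x ! i))"
        using continuous_map_compose[OF cont_\<psi>[OF that] f] by (simp add: o_def)
      have "continuous_map ?S (prod_topology (word_top d) (word_top d)) (\<lambda>x. (x, \<psi> x ! i))"
        by (intro continuous_map_pairedI cont_\<psi> that continuous_map_from_subtopology) simp
      \<comment> \<open>\<open>V\<close> is continuous only on \<open>G\<close>, so the pairs must
        be seen to land in \<open>G\<close> before composing.\<close>
      then have "continuous_map ?S (groupoid_top d G) (\<lambda>x. (x, \<psi> x ! i))"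
        unfolding groupoid_top_def using nth[OF _ that]
        by (intro continuous_map_into_subtopology) auto
      from continuous_map_compose[OF this V]
      have V': "continuous_map ?S euclideanreal (\<lambda>x. V (x, \<psi> x ! i))"
        by (simp add: o_def)
      have "continuous_map euclideanreal euclideanreal exp"
        by (simp add: continuous_on_exp)
      from continuous_map_compose[OF V' this]
      show "continuous_map ?S euclideanreal (\<lambda>x. exp (V (x, \<psi> x ! i)))"
        by (simp add: o_def)
    qed
    then show "continuous_map ?S euclideanreal (?g k)"
      by (intro continuous_map_real_mult[OF _ continuous_map_sum]) auto
  next
    fix x assume "x \<in> topspace (word_top d)"
    then have x: "x \<in> words d" by simp
    \<comment> \<open>A distinct list enumerating the class gives a bijection from its indices onto
      the class.\<close>
    have "(\<Sum>s \<in> G `` {x}. f s * exp (V (x, s)))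
        = (\<Sum>i<card (G `` {x}). f (\<psi> x ! i) * exp (V (x, \<psi> x ! i)))"
      using enum[OF x] length[OF x]
      by (intro sum.reindex_bij_betw[symmetric] bij_betw_nth) auto
    then show "\<exists>k. k \<in> UNIV \<and> x \<in> ?A k \<and> haar_op G V f x = ?g k x"
      using x by (auto simp: haar_op_def)
  qed auto
qed

section \<open>Transfer of integrals by quasi-invariance\<close>

theorem proposition6p1:
  fixes d :: nat and G :: "(word \<times> word) set" and c :: "word \<times> word \<Rightarrow> real"
    and \<beta> :: real and M :: "word measure"
  assumes "d \<ge> 1"
    and "equiv (words d) G"
    and "\<And>x. x \<in> words d \<Longrightarrow> finite (G `` {x})"
    and "hemicontinuous_map (word_top d) (word_top d) (\<lambda>x. G `` {x})"
    and "continuous_relation d G"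
    and "cocycle G c"
    and "continuous_map (groupoid_top d G) euclideanreal c"
    and "prob_space M"
    and "sets M = sets (borel_of_top (word_top d))"
    and "quasi_invariant d G c \<beta> M"
  shows "\<forall>f. continuous_map (word_top d) euclideanreal f \<longrightarrow>
           (LINT x|M. f x) = (LINT x|M. haar_op G (\<lambda>p. - \<beta> * c p) f x)"
proof (intro allI impI)
  fix f assume f: "continuous_map (word_top d) euclideanreal f"
  let ?V = "\<lambda>p. - \<beta> * c p"
  define h :: "word \<times> word \<Rightarrow> real" where "h = (\<lambda>p. f (snd p) / real (card (G `` {snd p})))"
  have space: "space M = words d"
    using sets_eq_imp_space_eq[OF assms(9)] by simp
  have fin: "finite_measure M"
    using assms(8) by (rule prob_space.finite_measure)
  have card_pos: "card (G `` {x}) > 0" if "x \<in> words d" for x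
    using assms(3)[OF that] equiv_class_self[OF assms(2) that] by (auto simp: card_gt_0_iff)
  have card_eq: "card (G `` {s}) = card (G `` {x})" if "s \<in> G `` {x}" for s x
    using equiv_class_eq[OF assms(2), of x s] that by simp
  \<comment> \<open>All summands are equal, and their number cancels the denominator, which is
    nonzero by \<open>card_pos\<close>.\<close>
  have left: "(\<Sum>s \<in> G `` {x}. h (s, x)) = f x" "(\<Sum>s \<in> G `` {x}. \<bar>h (s, x)\<bar>) = \<bar>f x\<bar>"
    if "x \<in> words d" for x
    using card_pos[OF that] by (simp_all add: h_def)
  \<comment> \<open>The denominator of \<open>h (x, s)\<close> is the size of the class of
    \<open>s\<close>, hence that of \<open>x\<close>, and factors out. With absolute values the sum
    is the Haar operator of \<bar>f\<bar>, so its integrability also follows from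
    continuity.\<close>
  have right: "(\<Sum>s \<in> G `` {x}. h (x, s) * exp (- \<beta> * c (x, s))) = haar_op G ?V f x"
    "(\<Sum>s \<in> G `` {x}. \<bar>h (x, s) * exp (- \<beta> * c (x, s))\<bar>) = haar_op G ?V (\<lambda>s. \<bar>f s\<bar>) x"
    for x
    unfolding haar_op_def sum_distrib_left h_def
    by (auto intro!: sum.cong simp: card_eq abs_mult)
  have V: "continuous_map (groupoid_top d G) euclideanreal ?V"
    by (intro continuous_map_real_mult assms(7)) simp
  have abs_f: "continuous_map (word_top d) euclideanreal (\<lambda>x. \<bar>f x\<bar>)"
    using f by (rule continuous_map_real_abs)
  \<comment> \<open>\<open>h\<close> is this quotient composed with \<open>snd\<close>, so its
    continuity on the groupoid reduces to continuity on the word space.\<close>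
  have "continuous_map (word_top d) euclideanreal (\<lambda>x. f x / real (card (G `` {x})))"
    using card_pos
    by (intro continuous_map_real_divide f continuous_map_card_class[OF assms(5)]) fastforce
  moreover have "continuous_map (groupoid_top d G) (word_top d) snd"
    unfolding groupoid_top_def
    by (intro continuous_map_from_subtopology continuous_map_snd)
  ultimately have "continuous_map (groupoid_top d G) euclideanreal h"
    using continuous_map_compose[of _ _ snd] unfolding h_def o_def by blast
  then have "h \<in> borel_measurable (borel_of_top (groupoid_top d G))"
    by (rule borel_measurable_if_continuous_map)
  moreover have "integrable M (\<lambda>x. \<Sum>s \<in> G `` {x}. \<bar>h (s, x)\<bar>)"
    using integrable_if_continuous_map[OF fin assms(9) abs_f]
    by (subst Bochner_Integration.integrable_cong[OF refl left(2)]) (simp_all add: space)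
  moreover have "integrable M (\<lambda>x. \<Sum>s \<in> G `` {x}. \<bar>h (x, s) * exp (- \<beta> * c (x, s))\<bar>)"
    unfolding right
    by (intro integrable_if_continuous_map[OF fin assms(9)]
        continuous_map_haar_op[OF assms(2,5) V abs_f])
  ultimately have transfer: "(LINT x|M. (\<Sum>s \<in> G `` {x}. h (s, x))) =
      (LINT x|M. (\<Sum>s \<in> G `` {x}. h (x, s) * exp (- \<beta> * c (x, s))))"
    using assms(10) unfolding quasi_invariant_def by blast
  have "(LINT x|M. f x) = (LINT x|M. (\<Sum>s \<in> G `` {x}. h (s, x)))"
    by (intro Bochner_Integration.integral_cong refl left(1)[symmetric]) (simp add: space)
  with transfer show "(LINT x|M. f x) = (LINT x|M. haar_op G ?V f x)"
    unfolding right by simp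
qed

end
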